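(* Let $I\subset(0,\infty)$ be an interval, let $f:I\to\mathbb{R}$ be a differentiable function on the interior $I^\circ$ of $I$, let $a,b\in I$ with $a<b$, and let $f'\in L[a,b]$. If $|f'|^q$ is harmonically convex on $[a,b]$ for $q\ge 1$, then $$\left|\frac{f(a)+f(b)}{2}-\frac{ab}{b-a}\int_a^b\frac{f(x)}{x^2}\,dx\right|\le \frac{ab(b-a)}{2}\,\lambda_1^{1-\frac1q}\left[\lambda_2|f'(a)|^q+\lambda_3|f'(b)|^q\right]^{\frac1q},$$ where $$\lambda_1=\frac{1}{ab}-\frac{2}{(b-a)^2}\ln\left(\frac{(a+b)^2}{4ab}\right),$$ $$\lambda_2=\frac{-1}{b(b-a)}+\frac{3a+b}{(b-a)^3}\ln\left(\frac{(a+b)^2}{4ab}\right),$$ $$\lambda_3=\frac{1}{a(b-a)}-\frac{3b+a}{(b-a)^3}\ln\left(\frac{(a+b)^2}{4ab}\right)=\lambda_1-\lambda_2.$$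
   Context: Let $J\subset\mathbb{R}\setminus\{0\}$ be a real interval. A function $g:J\to\mathbb{R}$ is called harmonically convex on $J$ if $$g\left(\frac{xy}{tx+(1-t)y}\right)\le t g(y)+(1-t)g(x)$$ for all $x,y\in J$ and $t\in[0,1]$. $L[a,b]$ denotes the space of Lebesgue integrable functions on $[a,b]$. *)

theory Defs
  imports "HOL-Analysis.Analysis"
begin

text \<open>As for \<open>convex_on\<close>, the condition on the domain (an interval not containing 0) is part
  of the notion.\<close>

definition harmonically_convex_on :: "real set \<Rightarrow> (real \<Rightarrow> real) \<Rightarrow> bool" where
  "harmonically_convex_on J g \<longleftrightarrow>
     is_interval J \<and> 0 \<notin> J \<and>
     (\<forall>x\<in>J. \<forall>y\<in>J. \<forall>t\<in>{0..1}.
        g (x * y / (t * x + (1 - t) * y)) \<le> t * g y + (1 - t) * g x)"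

definition lambda1 :: "real \<Rightarrow> real \<Rightarrow> real" where
  "lambda1 a b = 1 / (a * b) - 2 / (b - a)\<^sup>2 * ln ((a + b)\<^sup>2 / (4 * a * b))"

definition lambda2 :: "real \<Rightarrow> real \<Rightarrow> real" where
  "lambda2 a b = - 1 / (b * (b - a)) + (3 * a + b) / (b - a) ^ 3 * ln ((a + b)\<^sup>2 / (4 * a * b))"

definition lambda3 :: "real \<Rightarrow> real \<Rightarrow> real" where
  "lambda3 a b = 1 / (a * (b - a)) - (3 * b + a) / (b - a) ^ 3 * ln ((a + b)\<^sup>2 / (4 * a * b))"

end

theory Submission imports Defs begin

text \<open>Integration by parts writes the left-hand side as the integral of \<open>w * f'\<close> over \<open>{a..b}\<close>,
  where the kernel \<open>w x = ((a + b) * x - 2 * a * b) / (2 * (b - a) * x)\<close> runs from \<open>-1/2\<close>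
  to \<open>1/2\<close> and changes sign at the harmonic mean of \<open>a\<close> and \<open>b\<close>. Harmonic convexity bounds
  \<open>\<bar>f'\<bar> powr q\<close> by its harmonic chord, and the power mean inequality with weight \<open>\<bar>w\<bar>\<close>
  reduces the claim to two elementary integrals, which are multiples of \<open>lambda1\<close> and
  \<open>lambda2\<close>.\<close>

section \<open>Two general facts: a weighted power mean inequality and integrals against a
  sign-changing kernel\<close>

text \<open>Young's inequality is applied pointwise to \<open>G x\<close> and the constant
  \<open>m = T / S\<close>, the mean of \<open>G\<close> for the weight \<open>w\<close>, then
  multiplied by \<open>w x\<close> and integrated. The division by a power of \<open>m\<close> at
  the end forces \<open>T = 0\<close> to be treated apart.\<close>

lemma power_mean_integral:
  fixes w G :: "real \<Rightarrow> real"
  assumes "a < b" and w: "continuous_on {a..b} w" and G: "continuous_on {a..b} G"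
    and w0: "\<And>x. x \<in> {a..b} \<Longrightarrow> 0 \<le> w x" and G0: "\<And>x. x \<in> {a..b} \<Longrightarrow> 0 \<le> G x"
    and S: "0 < integral {a..b} w" and "1 \<le> q"
  shows "integral {a..b} (\<lambda>x. w x * G x powr (1 / q))
    \<le> integral {a..b} w powr (1 - 1 / q) * integral {a..b} (\<lambda>x. w x * G x) powr (1 / q)"
proof -
  define S where "S = integral {a..b} w"
  define T where "T = integral {a..b} (\<lambda>x. w x * G x)"
  have q: "0 \<le> 1 / q" "0 < 1 / q" "0 \<le> 1 - 1 / q"
    using \<open>1 \<le> q\<close> by auto
  have wG: "continuous_on {a..b} (\<lambda>x. w x * G x)"
    by (intro continuous_intros w G)
  have wGq: "continuous_on {a..b} (\<lambda>x. w x * G x powr (1 / q))"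
    by (intro continuous_on_mult w continuous_on_powr' G continuous_on_const) (use G0 q in auto)
  have hi_S: "(w has_integral S) {a..b}" and hi_T: "((\<lambda>x. w x * G x) has_integral T) {a..b}"
    unfolding S_def T_def using w wG by (auto intro: integrable_integral integrable_continuous_real)
  have T0: "0 \<le> T"
    using hi_T by (rule has_integral_nonneg) (simp add: w0 G0)
  show ?thesis
  proof (cases "T = 0")
    case True
    \<comment> \<open>A continuous nonnegative function with integral 0 vanishes everywhere; so at
      each point \<open>w x\<close> or \<open>G x\<close> is 0, and
      \<open>0 powr (1 / q) = 0\<close>.\<close>
    have "w x * G x = 0" if "x \<in> {a..b}" for x
      by (rule has_integral_0_cbox_imp_0[of a b "\<lambda>x. w x * G x"])
        (use wG w0 G0 that \<open>a < b\<close> hi_T True in auto)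
    then have "integral {a..b} (\<lambda>x. w x * G x powr (1 / q)) = integral {a..b} (\<lambda>x. 0)"
      by (intro integral_cong) force
    then show ?thesis
      by simp
  next
    case False
    define m where "m = T / S"
    have m: "0 < m" and T_eq: "T = m * S" and S0: "0 < S"
      using S T0 False by (auto simp: m_def S_def)
    have le: "integral {a..b} (\<lambda>x. w x * G x powr (1 / q)) * m powr (1 - 1 / q)
        \<le> 1 / q * T + (1 - 1 / q) * m * S"
    proof (rule has_integral_le)
      show "((\<lambda>x. w x * G x powr (1 / q) * m powr (1 - 1 / q)) has_integral
          integral {a..b} (\<lambda>x. w x * G x powr (1 / q)) * m powr (1 - 1 / q)) {a..b}"
        by (intro has_integral_mult_left integrable_integral integrable_continuous_real wGq)
      show "((\<lambda>x. 1 / q * (w x * G x) + (1 - 1 / q) * m * w x) has_integral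
          1 / q * T + (1 - 1 / q) * m * S) {a..b}"
        by (intro has_integral_add has_integral_mult_right hi_S hi_T)
      fix x assume x: "x \<in> {a..b}"
      have "G x powr (1 / q) * m powr (1 - 1 / q) \<le> 1 / q * G x + (1 - 1 / q) * m"
      \<comment> \<open>The library form of Young's inequality wants positive arguments; at a zero
        of \<open>G\<close> the left-hand side is 0.\<close>
      proof (cases "G x = 0")
        case True
        then show ?thesis
          using mult_nonneg_nonneg[OF q(3), of m] m by simp
      next
        case False
        then show ?thesis
          by (intro Youngs_inequality_0) (use q G0[OF x] m in auto)
      qed
      from mult_left_mono[OF this w0[OF x]]
      show "w x * G x powr (1 / q) * m powr (1 - 1 / q)
          \<le> 1 / q * (w x * G x) + (1 - 1 / q) * m * w x"
        by (simp add: algebra_simps)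
    qed
    \<comment> \<open>Since \<open>T = m * S\<close>, both Young terms are multiples of
      \<open>m * S\<close> and their coefficients sum to 1.\<close>
    have "1 / q * T + (1 - 1 / q) * m * S = m * S"
      unfolding T_eq by (simp add: algebra_simps)
    also have "\<dots> = m powr (1 / q) * S * m powr (1 - 1 / q)"
      using m by (simp add: mult.commute mult.left_commute flip: powr_add)
    finally have "integral {a..b} (\<lambda>x. w x * G x powr (1 / q)) \<le> m powr (1 / q) * S"
      using le m by simp
    also have "S = S powr (1 / q) * S powr (1 - 1 / q)"
      using S0 by (simp flip: powr_add)
    also have "m powr (1 / q) * \<dots> = S powr (1 - 1 / q) * T powr (1 / q)"
      unfolding T_eq using m S0 by (simp add: powr_mult)
    finally show ?thesis
      unfolding S_def T_def .
  qed
qed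

text \<open>The integrand has primitive \<open>- F\<close> left of \<open>h\<close> and
  \<open>F\<close> right of it, so \<open>F h\<close> is subtracted once from each side.\<close>

lemma has_integral_abs_sign_change:
  fixes w p F :: "real \<Rightarrow> real"
  assumes "a \<le> h" "h \<le> b"
    and F: "\<And>x. x \<in> {a..b} \<Longrightarrow> (F has_real_derivative w x * p x) (at x)"
    and "\<And>x. a \<le> x \<Longrightarrow> x \<le> h \<Longrightarrow> w x \<le> 0" and "\<And>x. h \<le> x \<Longrightarrow> x \<le> b \<Longrightarrow> 0 \<le> w x"
  shows "((\<lambda>x. \<bar>w x\<bar> * p x) has_integral F a + F b - 2 * F h) {a..b}"
proof -
  have "((\<lambda>x. - (w x * p x)) has_integral - F h - - F a) {a..h}"
    by (rule fundamental_theorem_of_calculus)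
      (use assms in \<open>auto simp flip: has_real_derivative_iff_has_vector_derivative
        intro!: DERIV_minus F[THEN DERIV_subset]\<close>)
  then have 1: "((\<lambda>x. \<bar>w x\<bar> * p x) has_integral - F h - - F a) {a..h}"
    by (rule has_integral_eq[rotated]) (use assms in auto)
  have "((\<lambda>x. w x * p x) has_integral F b - F h) {h..b}"
    by (rule fundamental_theorem_of_calculus)
      (use assms in \<open>auto simp flip: has_real_derivative_iff_has_vector_derivative
        intro!: F[THEN DERIV_subset]\<close>)
  then have 2: "((\<lambda>x. \<bar>w x\<bar> * p x) has_integral F b - F h) {h..b}"
    by (rule has_integral_eq[rotated]) (use assms in auto)
  from has_integral_combine[OF assms(1,2) 1 2] show ?thesis
    by (simp add: algebra_simps)
qed

section \<open>The kernel and the harmonic chord\<close>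

text \<open>The primitive of \<open>a * b / ((b - a) * x^2)\<close> with opposite values at
  \<open>a\<close> and \<open>b\<close>.\<close>

definition trapezoid_kernel :: "real \<Rightarrow> real \<Rightarrow> real \<Rightarrow> real" where
  "trapezoid_kernel a b x = ((a + b) * x - 2 * a * b) / (2 * (b - a) * x)"

text \<open>The number \<open>p\<close> with \<open>1 / x = p / a + (1 - p) / b\<close>: the
  barycentric coordinate of \<open>1 / x\<close> between \<open>1 / b\<close> and
  \<open>1 / a\<close>.\<close>

definition harmonic_weight :: "real \<Rightarrow> real \<Rightarrow> real \<Rightarrow> real" where
  "harmonic_weight a b x = a * (b - x) / (x * (b - a))"

lemma harmonic_weight_bounds:
  assumes "0 < a" "a < b" "x \<in> {a..b}"
  shows "0 \<le> harmonic_weight a b x" and "harmonic_weight a b x \<le> 1"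
proof -
  show "0 \<le> harmonic_weight a b x"
    using assms by (auto simp: harmonic_weight_def)
  have "0 \<le> b * (x - a)"
    using assms by auto
  then have "a * (b - x) \<le> x * (b - a)"
    by (simp add: algebra_simps)
  then show "harmonic_weight a b x \<le> 1"
    using assms by (auto simp: harmonic_weight_def)
qed

lemma continuous_on_trapezoid_kernel:
  assumes "0 < a" "a < b"
  shows "continuous_on {a..b} (trapezoid_kernel a b)"
  unfolding trapezoid_kernel_def using assms by (auto intro!: continuous_intros)

lemma continuous_on_harmonic_weight:
  assumes "0 < a" "a < b"
  shows "continuous_on {a..b} (harmonic_weight a b)"
  unfolding harmonic_weight_def using assms by (auto intro!: continuous_intros)

lemma harmonically_convex_on_chord:
  assumes "harmonically_convex_on {a..b} g" "0 < a" "a < b" "x \<in> {a..b}"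
  shows "g x \<le> harmonic_weight a b x * g a + (1 - harmonic_weight a b x) * g b"
proof -
  \<comment> \<open>In the definition of harmonic convexity \<open>t\<close> is the coefficient of
    \<open>g b\<close> here, hence the complement of the weight of \<open>a\<close>.\<close>
  define t where "t = 1 - harmonic_weight a b x"
  have t: "t \<in> {0..1}"
    using harmonic_weight_bounds[OF assms(2-4)] by (auto simp: t_def)
  have "t * a + (1 - t) * b = a * b / x"
    using assms by (simp add: t_def harmonic_weight_def divide_simps) (simp add: algebra_simps)
  then have "x = a * b / (t * a + (1 - t) * b)"
    using assms by simp
  then have "g x = g (a * b / (t * a + (1 - t) * b))"
    by simp
  also have "\<dots> \<le> t * g b + (1 - t) * g a"
    using assms t unfolding harmonically_convex_on_def by auto
  finally show ?thesis
    by (simp add: t_def)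
qed

section \<open>Closed forms of the weighted integrals of the kernel\<close>

context
  fixes a b :: real
  assumes ab: "0 < a" "a < b"
begin

definition "harmonic_mean = 2 * a * b / (a + b)"

lemma harmonic_mean_bounds: "a \<le> harmonic_mean" "harmonic_mean \<le> b"
proof -
  have "a * a \<le> a * b" "a * b \<le> b * b"
    using ab by auto
  then show "a \<le> harmonic_mean" "harmonic_mean \<le> b"
    using ab unfolding harmonic_mean_def by (simp_all add: field_simps)
qed

lemma trapezoid_kernel_sign:
  "a \<le> x \<Longrightarrow> x \<le> harmonic_mean \<Longrightarrow> trapezoid_kernel a b x \<le> 0"
  "harmonic_mean \<le> x \<Longrightarrow> x \<le> b \<Longrightarrow> 0 \<le> trapezoid_kernel a b x"
proof -
  assume x: "a \<le> x" "x \<le> harmonic_mean"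
  then have "(a + b) * x - 2 * a * b \<le> 0"
    using ab by (simp add: harmonic_mean_def field_simps)
  then show "trapezoid_kernel a b x \<le> 0"
    using x ab unfolding trapezoid_kernel_def by (intro divide_nonpos_nonneg) auto
next
  assume x: "harmonic_mean \<le> x" "x \<le> b"
  then have "0 \<le> (a + b) * x - 2 * a * b"
    using ab by (simp add: harmonic_mean_def field_simps)
  moreover have "a \<le> x"
    using x harmonic_mean_bounds by simp
  ultimately show "0 \<le> trapezoid_kernel a b x"
    using ab unfolding trapezoid_kernel_def by (intro divide_nonneg_nonneg) auto
qed

text \<open>The source of the logarithm in the lambdas: \<open>(a + b)^2 / (4 * a * b)\<close> is
  \<open>a * b\<close> divided by the square of the harmonic mean.\<close>

lemma ln_harmonic_mean: "2 * ln harmonic_mean = ln a + ln b - ln ((a + b)\<^sup>2 / (4 * a * b))"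
proof -
  have "ln (harmonic_mean\<^sup>2) = ln (a * b / ((a + b)\<^sup>2 / (4 * a * b)))"
    using ab by (simp add: harmonic_mean_def power2_eq_square field_simps)
  also have "\<dots> = ln a + ln b - ln ((a + b)\<^sup>2 / (4 * a * b))"
    using ab by (subst ln_divide_pos) (auto simp: ln_mult_pos)
  finally show ?thesis
    using ab by (simp add: ln_realpow harmonic_mean_def)
qed

lemma has_integral_abs_trapezoid_kernel:
  "((\<lambda>x. \<bar>trapezoid_kernel a b x\<bar>) has_integral a * b * (b - a) / 2 * lambda1 a b) {a..b}"
proof -
  define F where "F x = (a + b) / (2 * (b - a)) * x - a * b / (b - a) * ln x" for x
  let ?L = "ln ((a + b)\<^sup>2 / (4 * a * b))"
  have "((\<lambda>x. \<bar>trapezoid_kernel a b x\<bar> * 1) has_integral F a + F b - 2 * F harmonic_mean) {a..b}"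
  proof (rule has_integral_abs_sign_change)
    fix x assume "x \<in> {a..b}"
    then show "(F has_real_derivative trapezoid_kernel a b x * 1) (at x)"
      unfolding F_def using ab
      by (auto intro!: derivative_eq_intros simp: trapezoid_kernel_def divide_simps)
        (simp add: algebra_simps)
  qed (use harmonic_mean_bounds trapezoid_kernel_sign in auto)
  \<comment> \<open>Linear and logarithmic parts are separated. As
    \<open>a + b - 2 * harmonic_mean = (b - a)^2 / (a + b)\<close>, the former yields the term
    \<open>1 / (a * b)\<close> of \<open>lambda1\<close>.\<close>
  also have "F a + F b - 2 * F harmonic_mean = (a + b) / (2 * (b - a)) * (a + b - 2 * harmonic_mean)
      - a * b / (b - a) * (ln a + ln b - 2 * ln harmonic_mean)"
    unfolding F_def by (simp only: algebra_simps)
  also have "\<dots> = (a + b) / (2 * (b - a)) * (a + b - 2 * harmonic_mean) - a * b / (b - a) * ?L"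
    unfolding ln_harmonic_mean by simp
  also have "\<dots> = a * b * (b - a) / 2 * lambda1 a b"
    using ab unfolding lambda1_def harmonic_mean_def
    by (simp add: divide_simps power2_eq_square) (simp add: algebra_simps)
  finally show ?thesis
    by simp
qed

lemma has_integral_abs_trapezoid_kernel_harmonic_weight:
  "((\<lambda>x. \<bar>trapezoid_kernel a b x\<bar> * harmonic_weight a b x) has_integral
     a * b * (b - a) / 2 * lambda2 a b) {a..b}"
proof -
  define c where "c = a / (b - a)"
  define C where "C = (a + b) / (2 * (b - a))"
  define D where "D = a * b / (b - a)"
  \<comment> \<open>Termwise primitive of the expanded product of \<open>C - D / x\<close> (the
    kernel) and \<open>c * (b - x) / x\<close> (the weight).\<close>
  define F where "F x = c * ((C * b + D) * ln x - C * x + D * b / x)" for x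
  let ?L = "ln ((a + b)\<^sup>2 / (4 * a * b))"
  have "((\<lambda>x. \<bar>trapezoid_kernel a b x\<bar> * harmonic_weight a b x) has_integral
      F a + F b - 2 * F harmonic_mean) {a..b}"
  proof (rule has_integral_abs_sign_change)
    fix x assume x: "x \<in> {a..b}"
    have "(F has_real_derivative c * ((C * b + D) / x - C - D * b / (x * x))) (at x)"
      unfolding F_def using ab x
      by (auto intro!: derivative_eq_intros simp: power2_eq_square)
    also have "c * ((C * b + D) / x - C - D * b / (x * x)) = (C - D / x) * (c * (b - x) / x)"
      using ab x by (simp add: field_simps)
    also have "C - D / x = trapezoid_kernel a b x"
      using ab x by (simp add: C_def D_def trapezoid_kernel_def divide_simps)
        (simp add: algebra_simps)
    also have "c * (b - x) / x = harmonic_weight a b x"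
      using ab x by (simp add: c_def harmonic_weight_def)
    finally show "(F has_real_derivative trapezoid_kernel a b x * harmonic_weight a b x) (at x)" .
  qed (use harmonic_mean_bounds trapezoid_kernel_sign in auto)
  also have "F a + F b - 2 * F harmonic_mean =
      c * ((C * b + D) * (ln a + ln b - 2 * ln harmonic_mean) - C * (a + b - 2 * harmonic_mean)
        + D * b * (1 / a + 1 / b - 2 / harmonic_mean))"
    unfolding F_def by (simp add: algebra_simps)
  \<comment> \<open>The reciprocal terms cancel because the harmonic mean is the evaluation
    point.\<close>
  also have "1 / a + 1 / b - 2 / harmonic_mean = 0"
    using ab by (simp add: harmonic_mean_def field_simps)
  also have "C * (a + b - 2 * harmonic_mean) = (b - a) / 2"
    using ab by (simp add: C_def harmonic_mean_def divide_simps) (simp add: algebra_simps)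
  also have "ln a + ln b - 2 * ln harmonic_mean = ?L"
    unfolding ln_harmonic_mean by simp
  also have "C * b + D = b * (3 * a + b) / (2 * (b - a))"
    using ab by (simp add: C_def D_def divide_simps) (simp add: algebra_simps)
  also have "c * (b * (3 * a + b) / (2 * (b - a)) * ?L - (b - a) / 2 + D * b * 0)
      = a * b * (b - a) / 2 * lambda2 a b"
    using ab unfolding lambda2_def c_def
    by (simp add: divide_simps power3_eq_cube) (simp add: algebra_simps)
  finally show ?thesis .
qed

text \<open>This spares a third integration: the integral with weight
  \<open>1 - harmonic_weight a b x\<close> is the difference of the two computed above.\<close>

lemma lambda3_eq: "lambda3 a b = lambda1 a b - lambda2 a b"
proof -
  have "1 / (a * (b - a)) = 1 / (a * b) + 1 / (b * (b - a))"
    using ab by (simp add: divide_simps)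
  moreover have "(3 * b + a) / (b - a) ^ 3 = 2 / (b - a)\<^sup>2 + (3 * a + b) / (b - a) ^ 3"
    using ab by (simp add: divide_simps power2_eq_square power3_eq_cube)
  ultimately show ?thesis
    unfolding lambda1_def lambda2_def lambda3_def by (simp add: algebra_simps)
qed

section \<open>Integration by parts and the inequality on \<open>{a..b}\<close>\<close>

text \<open>The fundamental theorem integrates the derivative of
  \<open>trapezoid_kernel a b x * f x\<close>. Of its two product-rule terms, the one containing
  \<open>f x / x^2\<close> is continuous and is subtracted.\<close>

lemma has_integral_trapezoid_kernel_deriv:
  assumes f: "\<And>x. x \<in> {a..b} \<Longrightarrow> (f has_real_derivative f' x) (at x within {a..b})"
  shows "((\<lambda>x. trapezoid_kernel a b x * f' x) has_integral
    (f a + f b) / 2 - a * b / (b - a) * integral {a..b} (\<lambda>x. f x / x\<^sup>2)) {a..b}"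
proof -
  let ?w = "trapezoid_kernel a b"
  have w: "(?w has_real_derivative a * b / (b - a) * (1 / x\<^sup>2)) (at x within {a..b})"
    if "x \<in> {a..b}" for x
  proof -
    have "(?w has_real_derivative
        ((a + b) * (2 * (b - a) * x) - ((a + b) * x - 2 * a * b) * (2 * (b - a)))
        / (2 * (b - a) * x * (2 * (b - a) * x))) (at x within {a..b})"
      unfolding trapezoid_kernel_def using ab that
      by (auto intro!: derivative_eq_intros)
    also have "(a + b) * (2 * (b - a) * x) - ((a + b) * x - 2 * a * b) * (2 * (b - a))
        = 4 * (b - a) * a * b"
      by (simp add: algebra_simps)
    also have "4 * (b - a) * a * b / (2 * (b - a) * x * (2 * (b - a) * x))
        = a * b / (b - a) * (1 / x\<^sup>2)"
      using ab that by (simp add: divide_simps power2_eq_square) (simp add: algebra_simps)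
    finally show ?thesis .
  qed
  have "((\<lambda>x. a * b / (b - a) * (1 / x\<^sup>2) * f x + f' x * ?w x) has_integral
      ?w b * f b - ?w a * f a) {a..b}"
  proof (rule fundamental_theorem_of_calculus)
    fix x assume "x \<in> {a..b}"
    from DERIV_mult[OF w[OF this] f[OF this]]
    show "((\<lambda>x. ?w x * f x) has_vector_derivative
        a * b / (b - a) * (1 / x\<^sup>2) * f x + f' x * ?w x) (at x within {a..b})"
      unfolding has_real_derivative_iff_has_vector_derivative .
  qed (use ab in simp)
  \<comment> \<open>These endpoint values turn the boundary term into the mean of \<open>f a\<close>
    and \<open>f b\<close>.\<close>
  moreover have "?w b = 1 / 2" "?w a = - 1 / 2"
    using ab by (simp_all add: trapezoid_kernel_def divide_simps) (simp_all add: algebra_simps)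
  ultimately have parts: "((\<lambda>x. a * b / (b - a) * (f x / x\<^sup>2) + ?w x * f' x) has_integral
      (f a + f b) / 2) {a..b}"
    by (simp add: mult.commute add_divide_distrib add.commute)
  have "continuous_on {a..b} f"
    using f by (rule DERIV_continuous_on)
  then have "(\<lambda>x. f x / x\<^sup>2) integrable_on {a..b}"
    using ab by (intro integrable_continuous_real) (auto intro!: continuous_intros)
  then have "((\<lambda>x. a * b / (b - a) * (f x / x\<^sup>2)) has_integral
      a * b / (b - a) * integral {a..b} (\<lambda>x. f x / x\<^sup>2)) {a..b}"
    by (intro has_integral_mult_right integrable_integral)
  from has_integral_diff[OF parts this] show ?thesis
    by simp
qed

lemma trapezoid_harmonically_convex:
  assumes f: "\<And>x. x \<in> {a..b} \<Longrightarrow> (f has_real_derivative f' x) (at x within {a..b})"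
    and "1 \<le> q" and conv: "harmonically_convex_on {a..b} (\<lambda>x. \<bar>f' x\<bar> powr q)"
  shows "\<bar>(f a + f b) / 2 - a * b / (b - a) * integral {a..b} (\<lambda>x. f x / x\<^sup>2)\<bar>
    \<le> a * b * (b - a) / 2 * lambda1 a b powr (1 - 1 / q)
      * (lambda2 a b * \<bar>f' a\<bar> powr q + lambda3 a b * \<bar>f' b\<bar> powr q) powr (1 / q)"
proof -
  let ?w = "trapezoid_kernel a b" and ?p = "harmonic_weight a b"
  define K where "K = a * b * (b - a) / 2"
  define A where "A = \<bar>f' a\<bar> powr q"
  define B where "B = \<bar>f' b\<bar> powr q"
  \<comment> \<open>The harmonic chord that dominates \<open>\<bar>f' x\<bar> powr q\<close>; unlike
    that function it is visibly continuous, as \<open>power_mean_integral\<close> demands.\<close>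
  define G where "G x = ?p x * A + (1 - ?p x) * B" for x
  define R where "R = lambda2 a b * A + lambda3 a b * B"
  have K0: "0 < K"
    using ab by (simp add: K_def)
  have abs_w: "continuous_on {a..b} (\<lambda>x. \<bar>?w x\<bar>)"
    by (intro continuous_intros continuous_on_trapezoid_kernel ab)
  have G: "continuous_on {a..b} G"
    unfolding G_def by (intro continuous_intros continuous_on_harmonic_weight ab)
  have G0: "0 \<le> G x" if "x \<in> {a..b}" for x
    using harmonic_weight_bounds[OF ab that] by (simp add: G_def A_def B_def)
  have wGq: "continuous_on {a..b} (\<lambda>x. \<bar>?w x\<bar> * G x powr (1 / q))"
    by (intro continuous_on_mult abs_w continuous_on_powr' G continuous_on_const)
      (use G0 \<open>1 \<le> q\<close> in auto)
  have S: "((\<lambda>x. \<bar>?w x\<bar>) has_integral K * lambda1 a b) {a..b}"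
    unfolding K_def by (rule has_integral_abs_trapezoid_kernel)
  have "(\<lambda>x. \<bar>?w x\<bar> * G x) = (\<lambda>x. (A - B) * (\<bar>?w x\<bar> * ?p x) + B * \<bar>?w x\<bar>)"
    by (simp add: G_def fun_eq_iff algebra_simps)
  moreover have "((\<lambda>x. (A - B) * (\<bar>?w x\<bar> * ?p x) + B * \<bar>?w x\<bar>) has_integral
      (A - B) * (K * lambda2 a b) + B * (K * lambda1 a b)) {a..b}"
    using S has_integral_abs_trapezoid_kernel_harmonic_weight unfolding K_def
    by (intro has_integral_add has_integral_mult_right)
  ultimately have T: "((\<lambda>x. \<bar>?w x\<bar> * G x) has_integral K * R) {a..b}"
    by (simp add: R_def lambda3_eq algebra_simps)
  have "0 \<le> K * R"
    using T by (rule has_integral_nonneg) (simp add: G0)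
  then have R0: "0 \<le> R"
    using K0 by (simp add: zero_le_mult_iff)
  \<comment> \<open>A zero integral would make the continuous \<open>\<bar>?w x\<bar>\<close> vanish
    at \<open>b\<close>, where it equals 1/2.\<close>
  have "K * lambda1 a b \<noteq> 0"
  proof
    assume "K * lambda1 a b = 0"
    then have "\<bar>?w b\<bar> = 0"
      by (intro has_integral_0_cbox_imp_0[of a b "\<lambda>x. \<bar>?w x\<bar>"]) (use abs_w S ab in auto)
    then show False
      using ab by (simp add: trapezoid_kernel_def algebra_simps)
  qed
  moreover have "0 \<le> K * lambda1 a b"
    using S by (rule has_integral_nonneg) simp
  ultimately have S0: "0 < K * lambda1 a b"
    by linarith
  then have l0: "0 < lambda1 a b"
    using K0 by (simp add: zero_less_mult_iff)
  have bound: "norm (?w x * f' x) \<le> \<bar>?w x\<bar> * G x powr (1 / q)" if "x \<in> {a..b}" for x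
  proof -
    have "\<bar>f' x\<bar> = (\<bar>f' x\<bar> powr q) powr (1 / q)"
      using \<open>1 \<le> q\<close> by (simp add: powr_powr)
    also have "\<dots> \<le> G x powr (1 / q)"
      using harmonically_convex_on_chord[OF conv ab that] \<open>1 \<le> q\<close>
      by (intro powr_mono2) (auto simp: G_def A_def B_def)
    finally show ?thesis
      by (simp add: abs_mult mult_left_mono)
  qed
  note parts = has_integral_trapezoid_kernel_deriv[OF f]
  have "\<bar>(f a + f b) / 2 - a * b / (b - a) * integral {a..b} (\<lambda>x. f x / x\<^sup>2)\<bar>
      = norm (integral {a..b} (\<lambda>x. ?w x * f' x))"
    using integral_unique[OF parts] by simp
  also have "\<dots> \<le> integral {a..b} (\<lambda>x. \<bar>?w x\<bar> * G x powr (1 / q))"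
    using parts bound
    by (intro integral_norm_bound_integral[OF has_integral_integrable
          integrable_continuous_real[OF wGq]])
  also have "\<dots> \<le> (K * lambda1 a b) powr (1 - 1 / q) * (K * R) powr (1 / q)"
    using power_mean_integral[OF ab(2) abs_w G, of q] G0 S0 \<open>1 \<le> q\<close>
    unfolding integral_unique[OF S] integral_unique[OF T] by simp
  \<comment> \<open>The common factor \<open>K\<close> comes out with total exponent 1.\<close>
  also have "\<dots> = (K powr (1 - 1 / q) * K powr (1 / q)) * lambda1 a b powr (1 - 1 / q)
      * R powr (1 / q)"
    using K0 l0 R0 by (simp add: powr_mult)
  also have "K powr (1 - 1 / q) * K powr (1 / q) = K"
    using K0 by (simp flip: powr_add)
  finally show ?thesis
    unfolding K_def R_def A_def B_def .
qed

end

text \<open>The derivative assumptions at \<open>a\<close> and \<open>b\<close> tie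
  \<open>f' a\<close> and \<open>f' b\<close> to \<open>f\<close> when these points lie on the
  boundary of \<open>I\<close>. The proof passes to derivatives within \<open>{a..b}\<close> and to
  the gauge integral.\<close>

theorem theorem2:
  fixes I :: "real set" and f f' :: "real \<Rightarrow> real" and a b q :: real
  assumes "is_interval I" and "I \<subseteq> {0<..}"
    and "\<And>x. x \<in> interior I \<Longrightarrow> (f has_real_derivative f' x) (at x)"
    and "a \<in> I" and "b \<in> I" and "a < b"
    and "(f has_real_derivative f' a) (at a within I)"
    and "(f has_real_derivative f' b) (at b within I)"
    and "set_integrable lebesgue {a..b} f'"
    and "q \<ge> 1"
    and "harmonically_convex_on {a..b} (\<lambda>x. \<bar>f' x\<bar> powr q)"
  shows "\<bar>(f a + f b) / 2 - a * b / (b - a) * (LINT x:{a..b}|lebesgue. f x / x\<^sup>2)\<bar>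
           \<le> a * b * (b - a) / 2 * lambda1 a b powr (1 - 1 / q)
               * (lambda2 a b * \<bar>f' a\<bar> powr q + lambda3 a b * \<bar>f' b\<bar> powr q) powr (1 / q)
         \<and> lambda3 a b = lambda1 a b - lambda2 a b"
proof -
  have ab: "0 < a" "a < b"
    using assms by auto
  have sub: "{a..b} \<subseteq> I"
    using \<open>is_interval I\<close> \<open>a \<in> I\<close> \<open>b \<in> I\<close> unfolding is_interval_1
    by (meson atLeastAtMost_iff subsetI)
  have int: "{a<..<b} \<subseteq> interior I"
    using sub greaterThanLessThan_subseteq_atLeastAtMost_iff[of a b a b]
    by (intro interior_maximal open_greaterThanLessThan) blast
  have f: "(f has_real_derivative f' x) (at x within {a..b})" if x: "x \<in> {a..b}" for x
  proof -
    consider "x = a" | "x = b" | "x \<in> {a<..<b}"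
      using x by fastforce
    then show ?thesis
    proof cases
      case 3
      then show ?thesis
        by (rule has_field_derivative_at_within[OF assms(3)[OF subsetD[OF int]]])
    qed (use DERIV_subset[OF assms(7) sub] DERIV_subset[OF assms(8) sub] in simp_all)
  qed
  have "continuous_on {a..b} f"
    using f by (rule DERIV_continuous_on)
  then have "continuous_on {a..b} (\<lambda>x. f x / x\<^sup>2)"
    using ab by (auto intro!: continuous_intros)
  \<comment> \<open>The integrand is continuous on a compact interval, hence absolutely integrable,
    so Lebesgue and gauge integrals agree.\<close>
  then have "(LINT x:{a..b}|lebesgue. f x / x\<^sup>2) = integral {a..b} (\<lambda>x. f x / x\<^sup>2)"
    by (intro set_lebesgue_integral_eq_integral absolutely_integrable_continuous_real)
  then show ?thesis
    using trapezoid_harmonically_convex[OF ab f \<open>q \<ge> 1\<close> assms(11)] lambda3_eq[OF ab] by simp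
qed

end
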